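(* Let $G$ be a graph with $m$ edges, minimum degree $\delta\ge 1$ and maximum degree $\Delta>\delta+1$. Let $A_0,A_1,A_2$ denote the cardinalities of the following sets of edges, respectively: $$F_0=\{uv\in E(G): d_u=\delta,\ d_v=\Delta\},$$ $$F_1=\{uv\in E(G): d_u=\delta,\ \delta<d_v<\Delta\},$$ $$F_2=\{uv\in E(G): d_u=\Delta,\ \delta<d_v<\Delta\}.$$ If $\alpha>0$ is real, then $$SDD_{\alpha}(G)\le(m-A_1-A_2)\left(\frac{\Delta^{\alpha}}{\delta^{\alpha}}+\frac{\delta^{\alpha}}{\Delta^{\alpha}}\right)+A_1\left(\frac{(\Delta-1)^{\alpha}}{\delta^{\alpha}}+\frac{\delta^{\alpha}}{(\Delta-1)^{\alpha}}\right)+A_2\left(\frac{\Delta^{\alpha}}{(\delta+1)^{\alpha}}+\frac{(\delta+1)^{\alpha}}{\Delta^{\alpha}}\right)$$ and $$SDD_{\alpha}(G)\ge 2m+A_0\left(\frac{\Delta^{\alpha}}{\delta^{\alpha}}+\frac{\delta^{\alpha}}{\Delta^{\alpha}}-2\right)+A_1\left(\frac{(\delta+1)^{\alpha}}{\delta^{\alpha}}+\frac{\delta^{\alpha}}{(\delta+1)^{\alpha}}-2\right)+A_2\left(\frac{\Delta^{\alpha}}{(\Delta-1)^{\alpha}}+\frac{(\Delta-1)^{\alpha}}{\Delta^{\alpha}}-2\right).$$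
   Context: Graphs are finite, simple and undirected. For a graph $G$ with edge set $E(G)$, $d_u$ denotes the degree of the vertex $u$, and $uv$ denotes the (unordered) edge joining $u$ and $v$; in the definitions of sets of edges by conditions on $d_u,d_v$, an edge belongs to the set if its endpoints can be named $u,v$ so that the conditions hold. For $\alpha\in\mathbb{R}$, the variable symmetric division deg index is $$SDD_\alpha(G)=\sum_{uv\in E(G)}\left(\frac{d_u^\alpha}{d_v^\alpha}+\frac{d_v^\alpha}{d_u^\alpha}\right).$$ *)

theory Defs
  imports Complex_Main "Graph_Theory.Pair_Digraph"
begin

text \<open>
  A finite simple undirected graph is a \<^locale>\<open>pair_graph\<close>: a finite, loop-free, symmetric set of
  ordered pairs. Each undirected edge is represented there by two opposite arcs, so edges are counted
  and summed over as two-element sets of endpoints.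
\<close>

definition edges :: "'a pair_pre_digraph \<Rightarrow> 'a set set" where
  "edges G = {{u, v} | u v. (u, v) \<in> parcs G}"

text \<open>By symmetry the number of arcs leaving a vertex is its degree as a vertex of the graph.\<close>

definition degree :: "'a pair_pre_digraph \<Rightarrow> 'a \<Rightarrow> nat" where
  "degree G v = out_degree (with_proj G) v"

definition min_degree :: "'a pair_pre_digraph \<Rightarrow> nat" where
  "min_degree G = Min (degree G ` pverts G)"

definition max_degree :: "'a pair_pre_digraph \<Rightarrow> nat" where
  "max_degree G = Max (degree G ` pverts G)"

text \<open>
  The description below is unique because the summand is symmetric in the two endpoints; see
  \<open>sdd_weight_edge\<close>.
\<close>

definition sdd_weight :: "real \<Rightarrow> 'a pair_pre_digraph \<Rightarrow> 'a set \<Rightarrow> real" where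
  "sdd_weight \<alpha> G e =
     (THE w. \<exists>u v. e = {u, v} \<and>
        w = real (degree G u) powr \<alpha> / real (degree G v) powr \<alpha>
          + real (degree G v) powr \<alpha> / real (degree G u) powr \<alpha>)"

lemma sdd_weight_edge:
  "sdd_weight \<alpha> G {u, v} =
     real (degree G u) powr \<alpha> / real (degree G v) powr \<alpha>
   + real (degree G v) powr \<alpha> / real (degree G u) powr \<alpha>"
  unfolding sdd_weight_def by (rule the_equality) (auto simp: doubleton_eq_iff)

definition SDD :: "real \<Rightarrow> 'a pair_pre_digraph \<Rightarrow> real" where
  "SDD \<alpha> G = (\<Sum>e\<in>edges G. sdd_weight \<alpha> G e)"

lemma (in pair_graph) finite_edges: "finite (edges G)"
proof -
  have "edges G = (\<lambda>(u, v). {u, v}) ` parcs G"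
    unfolding edges_def by auto
  then show ?thesis
    using pair_finite_arcs by simp
qed

lemma (in pair_graph) degree_eq_card_incident_edges:
  "degree G v = card {e \<in> edges G. v \<in> e}"
proof -
  have sym: "(a, b) \<in> parcs G \<Longrightarrow> (b, a) \<in> parcs G" for a b
    using pair_sym_arcs by (auto simp: symmetric_def dest: symD)
  have "bij_betw (\<lambda>(a, b). {a, b}) (out_arcs (with_proj G) v) {e \<in> edges G. v \<in> e}"
    unfolding bij_betw_def
  proof
    show "inj_on (\<lambda>(a, b). {a, b}) (out_arcs (with_proj G) v)"
      by (auto simp: inj_on_def out_arcs_def doubleton_eq_iff)
    show "(\<lambda>(a, b). {a, b}) ` out_arcs (with_proj G) v = {e \<in> edges G. v \<in> e}"
      by (auto simp: out_arcs_def edges_def image_iff insert_commute) (use sym in fastforce)+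
  qed
  then show ?thesis
    unfolding degree_def out_degree_def by (rule bij_betw_same_card)
qed

end

theory Submission
  imports Defs
begin

text \<open>
  The weight of an edge depends only on the ratio of its end degrees and increases with
  the ratio of the larger to the smaller one. Within each class of edges the extreme ratios are
  known, because degrees are integers; summing the resulting bounds over the classes gives both
  inequalities.
\<close>

text \<open>The arguments are real rather than natural because the bounds also evaluate the weight
  at \<Delta> - 1, where truncated subtraction is best avoided.\<close>

definition sym_div :: "real \<Rightarrow> real \<Rightarrow> real \<Rightarrow> real" where
  "sym_div \<alpha> x y = x powr \<alpha> / y powr \<alpha> + y powr \<alpha> / x powr \<alpha>"

lemma sym_div_commute: "sym_div \<alpha> x y = sym_div \<alpha> y x"
  by (simp add: sym_div_def)

text \<open>The difference of the two sides factors as (t - s)(st - 1)/(st), and st is at least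
  1.\<close>

lemma add_inverse_mono:
  fixes s t :: real
  assumes "1 \<le> s" "s \<le> t"
  shows "s + 1 / s \<le> t + 1 / t"
proof -
  have "1 * 1 \<le> s * t"
    using assms by (intro mult_mono) auto
  then have "0 \<le> (t - s) * (s * t - 1) / (s * t)"
    using assms by (intro divide_nonneg_nonneg mult_nonneg_nonneg) auto
  also have "\<dots> = (t + 1 / t) - (s + 1 / s)"
    using assms by (simp add: field_simps)
  finally show ?thesis by simp
qed

text \<open>With r the ratio of the larger power to the smaller, the weight is r + 1/r. Enlarging
  the interval from [a', b'] to [a, b] can only increase r, which is at least 1 from the
  start.\<close>

lemma sym_div_mono:
  assumes "0 < a" "a \<le> a'" "a' \<le> b'" "b' \<le> b" "\<alpha> > 0"
  shows "sym_div \<alpha> a' b' \<le> sym_div \<alpha> a b"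
proof -
  have eq: "sym_div \<alpha> x y = y powr \<alpha> / x powr \<alpha> + 1 / (y powr \<alpha> / x powr \<alpha>)" for x y
    by (simp add: sym_div_def)
  have "1 \<le> b' powr \<alpha> / a' powr \<alpha>"
    using assms by (simp add: powr_mono2)
  moreover have "b' powr \<alpha> / a' powr \<alpha> \<le> b powr \<alpha> / a powr \<alpha>"
    using assms by (intro frac_le powr_mono2) auto
  ultimately show ?thesis
    unfolding eq by (rule add_inverse_mono)
qed

text \<open>The interval [a, b] contains the degenerate interval [a, a], whose weight is 2.\<close>

lemma sym_div_ge_2:
  assumes "0 < a" "a \<le> b" "\<alpha> > 0"
  shows "2 \<le> sym_div \<alpha> a b"
  using sym_div_mono[of a a a b \<alpha>] assms by (simp add: sym_div_def)

lemma (in pair_graph) min_degree_le: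
  assumes "v \<in> pverts G"
  shows "min_degree G \<le> degree G v"
  unfolding min_degree_def using assms pair_finite_verts by simp

lemma (in pair_graph) degree_le_max_degree:
  assumes "v \<in> pverts G"
  shows "degree G v \<le> max_degree G"
  unfolding max_degree_def using assms pair_finite_verts by simp

text \<open>Edges are unordered, so the endpoint of smaller degree may be named first. This puts the
  two degrees in the form of an interval, as \<open>sym_div_mono\<close> requires.\<close>

lemma (in pair_graph) edge_cases_by_degree:
  assumes "e \<in> edges G"
  obtains u v where "e = {u, v}" "min_degree G \<le> degree G u"
    "degree G u \<le> degree G v" "degree G v \<le> max_degree G"
proof -
  obtain u v where e: "e = {u, v}" and arc: "(u, v) \<in> parcs G"
    using assms by (auto simp: edges_def)
  have verts: "u \<in> pverts G" "v \<in> pverts G"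
    using in_arcsD1[OF arc] in_arcsD2[OF arc] by auto
  show thesis
    using that[of u v] that[of v u] e verts min_degree_le degree_le_max_degree
    by (cases "degree G u \<le> degree G v") (auto simp: insert_commute)
qed

lemma sum_indicator_subset:
  fixes c :: real
  assumes "finite E" "F \<subseteq> E"
  shows "(\<Sum>e\<in>E. if e \<in> F then c else 0) = real (card F) * c"
  using assms by (simp add: sum.inter_restrict[symmetric] Int_absorb1)

theorem theorem8:
  fixes G :: "'a pair_pre_digraph"
    and m \<delta> \<Delta> A\<^sub>0 A\<^sub>1 A\<^sub>2 :: nat
    and F\<^sub>0 F\<^sub>1 F\<^sub>2 :: "'a set set"
    and \<alpha> :: real
  assumes "pair_graph G"
    and "m = card (edges G)"
    and "\<delta> = min_degree G"
    and "\<Delta> = max_degree G"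
    and "\<delta> \<ge> 1"
    and "\<Delta> > \<delta> + 1"
    and "F\<^sub>0 = {e \<in> edges G. \<exists>u v. e = {u, v} \<and> degree G u = \<delta> \<and> degree G v = \<Delta>}"
    and "F\<^sub>1 = {e \<in> edges G. \<exists>u v. e = {u, v} \<and> degree G u = \<delta> \<and> \<delta> < degree G v \<and> degree G v < \<Delta>}"
    and "F\<^sub>2 = {e \<in> edges G. \<exists>u v. e = {u, v} \<and> degree G u = \<Delta> \<and> \<delta> < degree G v \<and> degree G v < \<Delta>}"
    and "A\<^sub>0 = card F\<^sub>0"
    and "A\<^sub>1 = card F\<^sub>1"
    and "A\<^sub>2 = card F\<^sub>2"
    and "\<alpha> > 0"
  shows "SDD \<alpha> G \<le>
        (real m - real A\<^sub>1 - real A\<^sub>2) *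
          (real \<Delta> powr \<alpha> / real \<delta> powr \<alpha> + real \<delta> powr \<alpha> / real \<Delta> powr \<alpha>)
      + real A\<^sub>1 *
          ((real \<Delta> - 1) powr \<alpha> / real \<delta> powr \<alpha> + real \<delta> powr \<alpha> / (real \<Delta> - 1) powr \<alpha>)
      + real A\<^sub>2 *
          (real \<Delta> powr \<alpha> / (real \<delta> + 1) powr \<alpha> + (real \<delta> + 1) powr \<alpha> / real \<Delta> powr \<alpha>)
    \<and> SDD \<alpha> G \<ge>
        2 * real m
      + real A\<^sub>0 *
          (real \<Delta> powr \<alpha> / real \<delta> powr \<alpha> + real \<delta> powr \<alpha> / real \<Delta> powr \<alpha> - 2)
      + real A\<^sub>1 *
          ((real \<delta> + 1) powr \<alpha> / real \<delta> powr \<alpha> + real \<delta> powr \<alpha> / (real \<delta> + 1) powr \<alpha> - 2)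
      + real A\<^sub>2 *
          (real \<Delta> powr \<alpha> / (real \<Delta> - 1) powr \<alpha> + (real \<Delta> - 1) powr \<alpha> / real \<Delta> powr \<alpha> - 2)"
proof -
  interpret pair_graph G by fact
  let ?w = "sym_div \<alpha>"
  have finE: "finite (edges G)" by (rule finite_edges)
  have sub: "F\<^sub>0 \<subseteq> edges G" "F\<^sub>1 \<subseteq> edges G" "F\<^sub>2 \<subseteq> edges G"
    using assms(7-9) by auto
  have \<delta>: "\<delta> \<ge> 1" "\<Delta> > \<delta> + 1" "\<alpha> > 0" by fact+

  \<comment> \<open>Each bound is a baseline valid for every edge, the largest possible weight above
    and 2 below, plus a correction for each special class. Summing a correction over all edges then
    produces the cardinality of its class.\<close>
  have bounds: "sdd_weight \<alpha> G e \<le> ?w \<delta> \<Delta>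
        + (if e \<in> F\<^sub>1 then ?w \<delta> (real \<Delta> - 1) - ?w \<delta> \<Delta> else 0)
        + (if e \<in> F\<^sub>2 then ?w (real \<delta> + 1) \<Delta> - ?w \<delta> \<Delta> else 0) \<and>
      2 + (if e \<in> F\<^sub>0 then ?w \<delta> \<Delta> - 2 else 0)
        + (if e \<in> F\<^sub>1 then ?w \<delta> (real \<delta> + 1) - 2 else 0)
        + (if e \<in> F\<^sub>2 then ?w (real \<Delta> - 1) \<Delta> - 2 else 0) \<le> sdd_weight \<alpha> G e"
    if e: "e \<in> edges G" for e
  proof -
    obtain u v where uv: "e = {u, v}" and
      ord: "\<delta> \<le> degree G u" "degree G u \<le> degree G v" "degree G v \<le> \<Delta>"
      using edge_cases_by_degree[OF e] assms(3,4) by metis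
    define x y where "x = degree G u" and "y = degree G v"
    have xy: "\<delta> \<le> x" "x \<le> y" "y \<le> \<Delta>"
      using ord by (simp_all add: x_def y_def)
    have weight: "sdd_weight \<alpha> G e = ?w x y"
      unfolding uv sdd_weight_edge sym_div_def x_def y_def ..
    \<comment> \<open>Since x \<le> y and \<delta> < \<Delta>, only one naming of the endpoints can
      satisfy the condition of each class. The resulting descriptions also show that the classes are
      disjoint, so an edge receives at most one correction on each side.\<close>
    have F\<^sub>0: "e \<in> F\<^sub>0 \<longleftrightarrow> x = \<delta> \<and> y = \<Delta>"
      using e ord \<delta> unfolding assms(7) uv x_def y_def by (auto simp: doubleton_eq_iff)
    have F\<^sub>1: "e \<in> F\<^sub>1 \<longleftrightarrow> x = \<delta> \<and> \<delta> < y \<and> y < \<Delta>"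
      using e ord \<delta> unfolding assms(8) uv x_def y_def by (auto simp: doubleton_eq_iff)
    have F\<^sub>2: "e \<in> F\<^sub>2 \<longleftrightarrow> y = \<Delta> \<and> \<delta> < x \<and> x < \<Delta>"
      using e ord \<delta> unfolding assms(9) uv x_def y_def by (auto simp: doubleton_eq_iff)
    consider "x = \<delta>" "y = \<Delta>" | "x = \<delta>" "\<delta> < y" "y < \<Delta>" | "y = \<Delta>" "\<delta> < x" "x < \<Delta>"
      | "e \<notin> F\<^sub>0" "e \<notin> F\<^sub>1" "e \<notin> F\<^sub>2"
      using F\<^sub>0 F\<^sub>1 F\<^sub>2 by blast
    then show ?thesis
    proof cases
      \<comment> \<open>Here the weight attains both bounds.\<close>
      case 1
      then show ?thesis
        using F\<^sub>0 F\<^sub>1 F\<^sub>2 \<delta> weight by simp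
    next
      case 2
      then have "e \<notin> F\<^sub>0" "e \<in> F\<^sub>1" "e \<notin> F\<^sub>2"
        using F\<^sub>0 F\<^sub>1 F\<^sub>2 by auto
      \<comment> \<open>Degrees are integers, so \<delta> + 1 \<le> y \<le> \<Delta> - 1: the
        interval [\<delta>, y] lies between [\<delta>, \<delta> + 1] and
        [\<delta>, \<Delta> - 1].\<close>
      moreover have "?w x y \<le> ?w \<delta> (real \<Delta> - 1)"
        using 2 \<delta> by (intro sym_div_mono) auto
      moreover have "?w \<delta> (real \<delta> + 1) \<le> ?w x y"
        using 2 \<delta> by (intro sym_div_mono) auto
      ultimately show ?thesis
        using weight by simp
    next
      case 3
      then have "e \<notin> F\<^sub>0" "e \<notin> F\<^sub>1" "e \<in> F\<^sub>2"
        using F\<^sub>0 F\<^sub>1 F\<^sub>2 by auto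
      \<comment> \<open>Now the upper end is fixed: integrality places [x, \<Delta>] between
        [\<Delta> - 1, \<Delta>] and [\<delta> + 1, \<Delta>].\<close>
      moreover have "?w x y \<le> ?w (real \<delta> + 1) \<Delta>"
        using 3 \<delta> by (intro sym_div_mono) auto
      moreover have "?w (real \<Delta> - 1) \<Delta> \<le> ?w x y"
        using 3 \<delta> by (intro sym_div_mono) auto
      ultimately show ?thesis
        using weight by simp
    next
      \<comment> \<open>Both degrees are equal to \<delta>, both are equal to \<Delta>, or both lie
        strictly between; the baselines alone suffice.\<close>
      case 4
      moreover have "?w x y \<le> ?w \<delta> \<Delta>"
        using xy \<delta> by (intro sym_div_mono) auto
      moreover have "2 \<le> ?w x y"
        using xy \<delta> by (intro sym_div_ge_2) auto
      ultimately show ?thesis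
        using weight by simp
    qed
  qed

  have "SDD \<alpha> G \<le> (\<Sum>e\<in>edges G. ?w \<delta> \<Delta>
        + (if e \<in> F\<^sub>1 then ?w \<delta> (real \<Delta> - 1) - ?w \<delta> \<Delta> else 0)
        + (if e \<in> F\<^sub>2 then ?w (real \<delta> + 1) \<Delta> - ?w \<delta> \<Delta> else 0))"
    unfolding SDD_def using bounds by (intro sum_mono) blast
  also have "\<dots> = real m * ?w \<delta> \<Delta> + real A\<^sub>1 * (?w \<delta> (real \<Delta> - 1) - ?w \<delta> \<Delta>)
      + real A\<^sub>2 * (?w (real \<delta> + 1) \<Delta> - ?w \<delta> \<Delta>)"
    using assms(2,11,12) finE sub by (simp only: sum.distrib sum_indicator_subset sum_constant)
  \<comment> \<open>The subtracted baselines are collected into the coefficient of the extreme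
    weight, and symmetry puts the arguments in the order of the claim.\<close>
  also have "\<dots> = (real m - real A\<^sub>1 - real A\<^sub>2) * ?w \<Delta> \<delta>
      + real A\<^sub>1 * ?w (real \<Delta> - 1) \<delta> + real A\<^sub>2 * ?w \<Delta> (real \<delta> + 1)"
    by (simp only: sym_div_commute[of \<alpha> \<Delta>] sym_div_commute[of \<alpha> "real \<Delta> - 1" \<delta>] algebra_simps)
  finally have upper: "SDD \<alpha> G \<le> \<dots>" .

  have "2 * real m + real A\<^sub>0 * (?w \<Delta> \<delta> - 2) + real A\<^sub>1 * (?w (real \<delta> + 1) \<delta> - 2)
      + real A\<^sub>2 * (?w \<Delta> (real \<Delta> - 1) - 2)
    = real m * 2 + real A\<^sub>0 * (?w \<delta> \<Delta> - 2) + real A\<^sub>1 * (?w \<delta> (real \<delta> + 1) - 2)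
      + real A\<^sub>2 * (?w (real \<Delta> - 1) \<Delta> - 2)"
    by (simp add: sym_div_commute)
  also have "\<dots> = (\<Sum>e\<in>edges G. 2 + (if e \<in> F\<^sub>0 then ?w \<delta> \<Delta> - 2 else 0)
        + (if e \<in> F\<^sub>1 then ?w \<delta> (real \<delta> + 1) - 2 else 0)
        + (if e \<in> F\<^sub>2 then ?w (real \<Delta> - 1) \<Delta> - 2 else 0))"
    using assms(2,10-12) finE sub by (simp only: sum.distrib sum_indicator_subset sum_constant)
  also have "\<dots> \<le> SDD \<alpha> G"
    unfolding SDD_def using bounds by (intro sum_mono) blast
  finally show ?thesis
    using upper unfolding sym_div_def by blast
qed

end
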